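(* Let $n,s,k$ be integers with $2\leq k$ and $k+2\leq s<n$. Let $\mathcal F\subset\binom{[n]}{s}$ be a family such that for every two distinct sets $A,B\in\mathcal F$ we have $1\leq |A\cap B|\leq k$. If $n\geq s^{5/2}$, then \[ |\mathcal F|\leq \frac{\binom{n-1}{k}}{\binom{s-1}{k}}. \]
   Context: $[n]=\{1,2,\dots,n\}$, and $\binom{[n]}{s}$ denotes the family of all $s$-element subsets of $[n]$. *)

theory Defs
  imports Complex_Main
begin

end

theory Submission
  imports Defs
begin

text \<open>
  Let \<open>R\<^sub>t = C(n-t, k+1-t) / C(s-t, k+1-t)\<close>. Two members of \<open>F\<close> share no \<open>(k+1)\<close>-set, so at most
  \<open>R\<^sub>t\<close> members contain a given \<open>t\<close>-set. A common element of all members therefore gives the claimed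
  bound \<open>R\<^sub>1\<close>. Otherwise branch on covers, using that every member of \<open>F\<close> is itself a cover: if \<open>F\<close>
  is covered by a pair, then \<open>|F| \<le> 2 s R\<^sub>2\<close>, and if not, then \<open>|F| \<le> s\<^sup>3 R\<^sub>3\<close>. Since
  \<open>R\<^sub>t \<ge> (n/s) R\<^sub>t\<^sub>+\<^sub>1 \<ge> s\<^sup>3\<^sup>/\<^sup>2 R\<^sub>t\<^sub>+\<^sub>1\<close>, both are at most \<open>R\<^sub>1\<close>.
\<close>

definition packing_bound :: "nat \<Rightarrow> nat \<Rightarrow> nat \<Rightarrow> nat \<Rightarrow> real"
  where "packing_bound n s k t =
    real ((n - t) choose (k + 1 - t)) / real ((s - t) choose (k + 1 - t))"

lemma packing_bound_nonneg: "0 \<le> packing_bound n s k t"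
  by (simp add: packing_bound_def)

text \<open>Apply the absorption identity C(L+1, m+1) = (L+1)/(m+1) * C(L, m) to numerator and
  denominator; the factors m+1 cancel.\<close>

lemma packing_bound_Suc:
  assumes "t \<le> k" "k < s" "s \<le> n"
  shows "packing_bound n s k t = (real (n - t) / real (s - t)) * packing_bound n s k (Suc t)"
proof -
  obtain m where m: "k + 1 - t = Suc m" "k + 1 - Suc t = m"
    using assms(1) by (metis Suc_diff_le Suc_eq_plus1 diff_Suc_Suc)
  obtain N where N: "n - t = Suc N" "n - Suc t = N"
    using assms by (metis Suc_diff_Suc le_less_trans less_le_trans)
  obtain S where S: "s - t = Suc S" "s - Suc t = S"
    using assms by (metis Suc_diff_Suc le_less_trans)
  have a: "real (Suc m) * real (Suc L choose Suc m) = real (Suc L) * real (L choose m)" for L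
    by (metis Suc_times_binomial of_nat_mult)
  have "real (Suc N choose Suc m) / real (Suc S choose Suc m)
      = (real (Suc m) * real (Suc N choose Suc m)) / (real (Suc m) * real (Suc S choose Suc m))"
    by (simp del: binomial_Suc_Suc of_nat_Suc)
  also have "\<dots> = (real (Suc N) / real (Suc S)) * (real (N choose m) / real (S choose m))"
    unfolding a by simp
  finally show ?thesis
    by (simp only: packing_bound_def m N S)
qed

text \<open>Since n/s is at least 1, subtracting t < s from both its terms cannot decrease it, so
  the ratio of consecutive bounds is at least n/s, hence at least \<open>q\<close>.\<close>

lemma packing_bound_Suc_le:
  assumes "t \<le> k" "k < s" "s \<le> n" "q * real s \<le> real n"
  shows "q * packing_bound n s k (Suc t) \<le> packing_bound n s k t"
proof -
  have "real n * real (s - t) \<le> real (n - t) * real s"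
    using assms by (simp add: of_nat_diff algebra_simps mult_right_mono)
  then have "real n / real s \<le> real (n - t) / real (s - t)"
    using assms by (simp add: field_simps)
  moreover have "q \<le> real n / real s"
    using assms by (simp add: field_simps)
  ultimately show ?thesis
    unfolding packing_bound_Suc[OF assms(1-3)]
    by (intro mult_right_mono packing_bound_nonneg) simp
qed

text \<open>Double counting: for a member A containing T, each U in \<open>P A\<close> extends to
  the (k+1)-set U \<union> T inside A. No two members share such a set, so the families
  \<open>P A\<close> are pairwise disjoint subfamilies of \<open>P V\<close>.\<close>

lemma card_star_le_packing_bound:
  fixes F :: "'a set set"
  assumes "finite V" "card V = n" "k < s"
    and F: "\<And>A. A \<in> F \<Longrightarrow> A \<subseteq> V \<and> card A = s"
    and inter: "\<And>A B. A \<in> F \<Longrightarrow> B \<in> F \<Longrightarrow> A \<noteq> B \<Longrightarrow> card (A \<inter> B) \<le> k"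
    and T: "T \<subseteq> V" "card T = t" "t \<le> k + 1"
  shows "real (card {A \<in> F. T \<subseteq> A}) \<le> packing_bound n s k t"
proof -
  define G where "G = {A \<in> F. T \<subseteq> A}"
  define P where "P X = {U. U \<subseteq> X - T \<and> card U = k + 1 - t}" for X
  have finT: "finite T" using T assms(1) finite_subset by blast
  have finA: "finite A" if "A \<in> G" for A
    using that F[of A] finite_subset[OF _ assms(1), of A] by (simp add: G_def)
  have finG: "finite G"
    by (rule finite_subset[of _ "Pow V"]) (use F assms(1) in \<open>auto simp: G_def\<close>)
  have cP: "card (P A) = (s - t) choose (k + 1 - t)" if "A \<in> G" for A
    unfolding P_def using that F finA[OF that] finT T
    by (subst n_subsets) (auto simp: G_def card_Diff_subset)
  have cV: "card (P V) = (n - t) choose (k + 1 - t)"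
    unfolding P_def using assms(1,2) finT T by (subst n_subsets) (auto simp: card_Diff_subset)
  have disj: "P A \<inter> P B = {}" if "A \<in> G" "B \<in> G" "A \<noteq> B" for A B
  proof (rule ccontr)
    assume "P A \<inter> P B \<noteq> {}"
    then obtain U where U: "U \<subseteq> A - T" "U \<subseteq> B - T" "card U = k + 1 - t"
      unfolding P_def by auto
    have "finite U" using U finA[OF that(1)] by (meson finite_Diff finite_subset)
    then have "card (U \<union> T) = card U + card T"
      using U finT by (intro card_Un_disjoint) auto
    also have "\<dots> = k + 1" using U T by simp
    finally have "card (U \<union> T) = k + 1" .
    moreover have "card (U \<union> T) \<le> card (A \<inter> B)"
      using U that finA[OF that(1)] by (intro card_mono) (auto simp: G_def)
    ultimately show False using inter[of A B] that by (auto simp: G_def)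
  qed
  have finPV: "finite (P V)"
    by (rule finite_subset[of _ "Pow V"]) (use assms(1) in \<open>auto simp: P_def\<close>)
  have sub: "P A \<subseteq> P V" if "A \<in> G" for A
    using that F[of A] by (auto simp: P_def G_def)
  have "card G * ((s - t) choose (k + 1 - t)) = (\<Sum>A\<in>G. card (P A))"
    using cP by simp
  also have "\<dots> = card (\<Union>A\<in>G. P A)"
    using finG disj finite_subset[OF sub finPV]
    by (intro card_UN_disjoint[symmetric]) auto
  also have "\<dots> \<le> (n - t) choose (k + 1 - t)"
    unfolding cV[symmetric] by (intro card_mono finPV) (use sub in blast)
  finally have "real (card G) * real ((s - t) choose (k + 1 - t)) \<le> real ((n - t) choose (k + 1 - t))"
    by (metis of_nat_le_iff of_nat_mult)
  moreover have "0 < (s - t) choose (k + 1 - t)"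
    using assms(3) by simp
  ultimately show ?thesis
    unfolding packing_bound_def G_def by (simp add: pos_le_divide_eq)
qed

text \<open>One branching step: every member containing T meets C, so it also contains
  \<open>insert x T\<close> for some x in C. Below, C is usually a member of F that avoids T, so
  that T really grows.\<close>

lemma card_star_le_cover:
  fixes F :: "'a set set"
  assumes "finite C" "\<And>A. A \<in> F \<Longrightarrow> T \<subseteq> A \<Longrightarrow> A \<inter> C \<noteq> {}"
    and M: "\<And>x. x \<in> C \<Longrightarrow> real (card {A \<in> F. insert x T \<subseteq> A}) \<le> M"
    and "finite F"
  shows "real (card {A \<in> F. T \<subseteq> A}) \<le> real (card C) * M"
proof -
  have "card {A \<in> F. T \<subseteq> A} \<le> card (\<Union>x\<in>C. {A \<in> F. insert x T \<subseteq> A})"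
  proof (rule card_mono)
    show "{A \<in> F. T \<subseteq> A} \<subseteq> (\<Union>x\<in>C. {A \<in> F. insert x T \<subseteq> A})"
      using assms(2) by fastforce
  qed (use assms(1,4) in auto)
  also have "\<dots> \<le> (\<Sum>x\<in>C. card {A \<in> F. insert x T \<subseteq> A})"
    using assms(1) by (rule card_UN_le)
  finally have "real (card {A \<in> F. T \<subseteq> A}) \<le> (\<Sum>x\<in>C. real (card {A \<in> F. insert x T \<subseteq> A}))"
    by (simp only: of_nat_le_iff flip: of_nat_sum)
  also have "\<dots> \<le> real (card C) * M"
    using M by (rule sum_bounded_above)
  finally show ?thesis .
qed

theorem theorem1p5:
  fixes n s k :: nat and F :: "nat set set"
  assumes "2 \<le> k" and "k + 2 \<le> s" and "s < n"
    and "F \<subseteq> {A. A \<subseteq> {1..n} \<and> card A = s}"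
    and "\<And>A B. A \<in> F \<Longrightarrow> B \<in> F \<Longrightarrow> A \<noteq> B \<Longrightarrow> 1 \<le> card (A \<inter> B) \<and> card (A \<inter> B) \<le> k"
    and "real n \<ge> real s powr (5 / 2)"
  shows "real (card F) \<le> real ((n - 1) choose k) / real ((s - 1) choose k)"
proof -
  let ?R = "packing_bound n s k"
  \<comment> \<open>\<open>q\<close> is a lower bound for n/s. Two gains of \<open>q\<close> pay
    exactly for three branchings of width s, as q^2 = s^3; one gain pays for width 2s, as sqrt s
    \<ge> 2.\<close>
  define q where "q = real s powr (3/2)"
  have s4: "4 \<le> real s" using assms(1,2) by simp
  have qs: "q * real s \<le> real n"
    using assms(6) s4 powr_add[of "real s" "3/2" 1] by (simp add: q_def)
  have q_square: "q * q = real s ^ 3"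
    using s4 powr_add[of "real s" "3/2" "3/2"] by (simp add: q_def flip: powr_numeral)
  have "2 = sqrt 4" by simp
  also have "\<dots> \<le> sqrt (real s)" using s4 by (rule real_sqrt_le_mono)
  finally have "2 * real s \<le> real s powr (1/2) * real s"
    using s4 by (intro mult_right_mono) (simp_all add: powr_half_sqrt)
  also have "\<dots> = q" using s4 powr_add[of "real s" "1/2" 1] by (simp add: q_def)
  finally have q_ge: "2 * real s \<le> q" .
  have R12: "q * ?R 2 \<le> ?R 1"
    using packing_bound_Suc_le[of 1 k s n q] qs assms(1-3) by (simp add: numeral_2_eq_2)
  have R23: "q * ?R 3 \<le> ?R 2"
    using packing_bound_Suc_le[of 2 k s n q] qs assms(1-3) by (simp add: numeral_3_eq_3)
  have R1: "?R 1 = real ((n - 1) choose k) / real ((s - 1) choose k)"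
    by (simp add: packing_bound_def)

  have inF: "A \<subseteq> {1..n}" "card A = s" "finite A" if "A \<in> F" for A
    using that assms(4) finite_subset[of A "{1..n}"] by auto
  have finF: "finite F"
    by (rule finite_subset[of _ "Pow {1..n}"]) (use inF in auto)
  \<comment> \<open>This makes every member a cover of F; when A = B, it holds because s >
    0.\<close>
  have meet: "A \<inter> B \<noteq> {}" if "A \<in> F" "B \<in> F" for A B
    using assms(5)[OF that] inF(2)[OF that(1)] s4 by (cases "A = B") auto
  \<comment> \<open>Sizes up to 3 are allowed because k \<ge> 2 gives 3 \<le> k + 1.\<close>
  have star: "real (card {A \<in> F. T \<subseteq> A}) \<le> ?R t"
    if "T \<subseteq> {1..n}" "card T = t" "t \<le> 3" for T t
    by (rule card_star_le_packing_bound[of "{1..n}"])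
      (use that assms(1,2) inF assms(5) in auto)

  have "real (card F) \<le> ?R 1"
  proof (cases "F = {}")
    case True
    then show ?thesis by (simp add: packing_bound_nonneg)
  next
    case False
    then obtain A where A: "A \<in> F" by blast
    show ?thesis
    proof (cases "\<exists>x. \<forall>B\<in>F. x \<in> B")
      case True
      then obtain x where x: "\<forall>B\<in>F. x \<in> B" by blast
      then have "{A \<in> F. {x} \<subseteq> A} = F" by auto
      moreover have "x \<in> {1..n}" using x A inF(1) by blast
      ultimately show ?thesis using star[of "{x}" 1] by simp
    next
      case False
      then obtain B where B: "\<And>x. B x \<in> F" "\<And>x. x \<notin> B x" by metis
      show ?thesis
      proof (cases "\<exists>x y. \<forall>C\<in>F. x \<in> C \<or> y \<in> C")
        case True
        then obtain x y where xy: "\<forall>C\<in>F. x \<in> C \<or> y \<in> C" by blast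
        \<comment> \<open>The member \<open>B y\<close> misses y, so it must contain x, which puts x
          in the ground set; symmetrically for y.\<close>
        then have V: "x \<in> {1..n}" "y \<in> {1..n}"
          using B(2) inF(1)[OF B(1)[of y]] inF(1)[OF B(1)[of x]] B(1) by (metis subsetD)+
        \<comment> \<open>Branch over \<open>B z\<close>: it misses z, so each of its points forms a
          genuine pair with z.\<close>
        have "real (card {C \<in> F. {z} \<subseteq> C}) \<le> real (card (B z)) * ?R 2" if "z \<in> {x, y}" for z
        proof (rule card_star_le_cover)
          fix w assume w: "w \<in> B z"
          show "real (card {C \<in> F. insert w {z} \<subseteq> C}) \<le> ?R 2"
          proof (rule star)
            show "insert w {z} \<subseteq> {1..n}" using w V that inF(1)[OF B(1)[of z]] by blast
            have "w \<noteq> z" using w B(2) by blast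
            then show "card (insert w {z}) = 2" by simp
          qed simp
        qed (use B inF finF meet in auto)
        then have "real (card {C \<in> F. {} \<subseteq> C}) \<le> real (card {x, y}) * (real s * ?R 2)"
          using B inF finF xy by (intro card_star_le_cover) auto
        also have "\<dots> \<le> 2 * (real s * ?R 2)"
          by (intro mult_right_mono) (simp_all add: card_insert_if packing_bound_nonneg)
        also have "\<dots> \<le> q * ?R 2"
          using mult_right_mono[OF q_ge packing_bound_nonneg[of n s k 2]] by (simp add: mult.assoc)
        finally show ?thesis using R12 by simp
      next
        case False
        \<comment> \<open>As no pair covers F, \<open>C x y\<close> can be chosen to avoid both x
          and y.\<close>
        then obtain C where C: "\<And>x y. C x y \<in> F" "\<And>x y. x \<notin> C x y" "\<And>x y. y \<notin> C x y"
          by metis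
        \<comment> \<open>Three-level branching, built from the innermost level outwards: x in A,
          then y in \<open>B x\<close>, then z in \<open>C x y\<close>. Each new point differs from
          the earlier ones, so the leaves are 3-sets.\<close>
        have "real (card {D \<in> F. {y, x} \<subseteq> D}) \<le> real (card (C x y)) * ?R 3"
          if "x \<in> A" "y \<in> B x" for x y
        proof (rule card_star_le_cover)
          fix z assume z: "z \<in> C x y"
          show "real (card {D \<in> F. insert z {y, x} \<subseteq> D}) \<le> ?R 3"
          proof (rule star)
            show "insert z {y, x} \<subseteq> {1..n}"
              using z that inF(1)[OF A] inF(1)[OF B(1)[of x]] inF(1)[OF C(1)[of x y]] by blast
            have "z \<noteq> x" "z \<noteq> y" "y \<noteq> x" using z that B(2) C(2,3) by blast+
            then show "card (insert z {y, x}) = 3" by simp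
          qed simp
        qed (use C inF finF meet in auto)
        then have "real (card {D \<in> F. {x} \<subseteq> D}) \<le> real (card (B x)) * (real s * ?R 3)"
          if "x \<in> A" for x
          using that B C inF finF meet by (intro card_star_le_cover) auto
        then have "real (card {D \<in> F. {} \<subseteq> D}) \<le> real (card A) * (real s * (real s * ?R 3))"
          using A B inF finF meet by (intro card_star_le_cover) auto
        also have "\<dots> = q * (q * ?R 3)"
          using inF(2)[OF A] q_square by (simp add: power3_eq_cube flip: mult.assoc)
        also have "\<dots> \<le> q * ?R 2"
          using R23 by (intro mult_left_mono) (simp_all add: q_def)
        finally show ?thesis using R12 by simp
      qed
    qed
  qed
  then show ?thesis unfolding R1 .
qed

end
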